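(* There is a universal constant $C$ such that for every Boolean function $f:\{0,1\}^n\to\{0,1\}$, $\mathrm{D}(f)\le C\,\mathrm{Q}(f)^4$.
   Context: $\mathrm{D}(f)$ is the deterministic query complexity of $f$: the minimum, over deterministic algorithms that compute $f(x)$ by querying bits of $x$, of the worst-case number of queries. $\mathrm{Q}(f)$ is the bounded-error quantum query complexity: the minimum number of queries of a quantum query algorithm that outputs $f(x)$ with probability at least $2/3$ on every input $x$. *)

theory Defs
  imports Complex_Main
begin

text \<open>A Boolean function on n bits is a function f :: bool list => bool, of which only
the values on lists of length n matter. Bit x_i (0 <= i < n) is x ! i; True = 1.\<close>

datatype dtree = Leaf bool | Query nat dtree dtree

fun dt_eval :: "dtree \<Rightarrow> bool list \<Rightarrow> bool" where
  "dt_eval (Leaf b) x = b"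
| "dt_eval (Query i t0 t1) x = (if x ! i then dt_eval t1 x else dt_eval t0 x)"

fun dt_depth :: "dtree \<Rightarrow> nat" where
  "dt_depth (Leaf b) = 0"
| "dt_depth (Query i t0 t1) = Suc (max (dt_depth t0) (dt_depth t1))"

fun dt_valid :: "nat \<Rightarrow> dtree \<Rightarrow> bool" where
  "dt_valid n (Leaf b) = True"
| "dt_valid n (Query i t0 t1) = (i < n \<and> dt_valid n t0 \<and> dt_valid n t1)"

definition dt_computes :: "nat \<Rightarrow> dtree \<Rightarrow> (bool list \<Rightarrow> bool) \<Rightarrow> bool" where
  "dt_computes n t f \<longleftrightarrow> dt_valid n t \<and> (\<forall>x. length x = n \<longrightarrow> dt_eval t x = f x)"

definition D :: "nat \<Rightarrow> (bool list \<Rightarrow> bool) \<Rightarrow> nat" where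
  "D n f = (LEAST d. \<exists>t. dt_computes n t f \<and> dt_depth t = d)"

text \<open>Quantum query algorithms in the standard (phase-oracle) model.
The Hilbert space is C^N with N = (n+1)*k; basis state j encodes the query register
i = j mod (n+1) in {0..n} and a workspace of dimension k >= 1.
The query operator O_x maps |j> to (-1)^(x_{i-1}) |j> when i >= 1 and leaves it unchanged when
i = 0 (the "null query"). A T-query algorithm is a sequence of unitaries U_0,...,U_T on C^N;
it prepares U_T O_x U_{T-1} ... O_x U_0 |0>, measures in the computational basis and
outputs 1 iff the outcome lies in the accepting set S.
Vectors are functions nat => complex (only indices < N matter), matrices nat => nat => complex.\<close>

definition unitary_mat :: "nat \<Rightarrow> (nat \<Rightarrow> nat \<Rightarrow> complex) \<Rightarrow> bool" where
  "unitary_mat N U \<longleftrightarrow>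
     (\<forall>i<N. \<forall>j<N. (\<Sum>l<N. cnj (U l i) * U l j) = (if i = j then 1 else 0))"

definition mat_app :: "nat \<Rightarrow> (nat \<Rightarrow> nat \<Rightarrow> complex) \<Rightarrow> (nat \<Rightarrow> complex) \<Rightarrow> (nat \<Rightarrow> complex)" where
  "mat_app N U v = (\<lambda>i. \<Sum>j<N. U i j * v j)"

definition phase_query :: "nat \<Rightarrow> bool list \<Rightarrow> (nat \<Rightarrow> complex) \<Rightarrow> (nat \<Rightarrow> complex)" where
  "phase_query n x v = (\<lambda>j. (if j mod (n+1) = 0 then 1
                        else if x ! (j mod (n+1) - 1) then -1 else 1) * v j)"

fun q_state :: "nat \<Rightarrow> nat \<Rightarrow> (nat \<Rightarrow> nat \<Rightarrow> nat \<Rightarrow> complex) \<Rightarrow> bool list \<Rightarrow> nat \<Rightarrow> (nat \<Rightarrow> complex)" where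
  "q_state n N U x 0 = mat_app N (U 0) (\<lambda>j. if j = 0 then 1 else 0)"
| "q_state n N U x (Suc t) = mat_app N (U (Suc t)) (phase_query n x (q_state n N U x t))"

definition accept_prob :: "nat \<Rightarrow> nat \<Rightarrow> (nat \<Rightarrow> nat \<Rightarrow> nat \<Rightarrow> complex) \<Rightarrow> nat set \<Rightarrow> nat \<Rightarrow> bool list \<Rightarrow> real" where
  "accept_prob n k U S T x = (\<Sum>j\<in>S \<inter> {..<(n+1)*k}. (cmod (q_state n ((n+1)*k) U x T j))\<^sup>2)"

definition q_computes :: "nat \<Rightarrow> nat \<Rightarrow> nat \<Rightarrow> (nat \<Rightarrow> nat \<Rightarrow> nat \<Rightarrow> complex) \<Rightarrow> nat set \<Rightarrow> (bool list \<Rightarrow> bool) \<Rightarrow> bool" where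
  "q_computes n T k U S f \<longleftrightarrow>
     k \<ge> 1 \<and> (\<forall>t\<le>T. unitary_mat ((n+1)*k) (U t)) \<and>
     (\<forall>x. length x = n \<longrightarrow>
        (if f x then accept_prob n k U S T x \<ge> 2/3 else 1 - accept_prob n k U S T x \<ge> 2/3))"

definition Q :: "nat \<Rightarrow> (bool list \<Rightarrow> bool) \<Rightarrow> nat" where
  "Q n f = (LEAST T. \<exists>k U S. q_computes n T k U S f)"

end

theory Submission
  imports Defs
begin

text \<open>
  Two consequences of the positive-weight adversary method are combined. A star of disjoint sensitive
  blocks gives block sensitivity \<open>O(Q\<^sup>2)\<close>. If the multilinear polynomial of \<open>f\<close> has a monomial \<open>M\<close>, then on
  a subcube with free coordinates \<open>M\<close> one of the two sets where \<open>f\<close> agrees or disagrees with parity has more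
  than half of the vertices; edges inside it are sensitive, and Huang's signed adjacency
  operator provides weights on it with Rayleigh quotient at least \<open>sqrt |M|\<close>, so \<open>|M| = O(Q\<^sup>2)\<close>. Finally,
  a decision tree that repeatedly queries all variables of a monomial of maximal degree of the restricted
  function stops after at most block-sensitivity many rounds, since every such monomial contains a
  sensitive block of the actual input. Since \<open>Q\<close> is a \<open>LEAST\<close>, the existence of some quantum
  algorithm has to be shown as well: one that learns the input bit by bit.
\<close>

section \<open>Adversary bound\<close>

definition ip :: "nat \<Rightarrow> (nat \<Rightarrow> complex) \<Rightarrow> (nat \<Rightarrow> complex) \<Rightarrow> complex" where
  "ip N u v = (\<Sum>j<N. cnj (u j) * v j)"

lemma ip_self: "ip N u u = of_real (\<Sum>j<N. (cmod (u j))\<^sup>2)"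
  unfolding ip_def of_real_sum
  by (intro sum.cong refl) (metis complex_norm_square mult.commute)

lemma ip_mat_app:
  assumes "unitary_mat N U"
  shows "ip N (mat_app N U u) (mat_app N U v) = ip N u v"
proof -
  have "ip N (mat_app N U u) (mat_app N U v)
      = (\<Sum>l<N. \<Sum>i<N. \<Sum>j<N. (cnj (u i) * v j) * (cnj (U l i) * U l j))"
    unfolding ip_def mat_app_def cnj_sum sum_product
    by (intro sum.cong refl) (simp add: algebra_simps)
  also have "\<dots> = (\<Sum>i<N. \<Sum>l<N. \<Sum>j<N. (cnj (u i) * v j) * (cnj (U l i) * U l j))"
    by (rule sum.swap)
  also have "\<dots> = (\<Sum>i<N. \<Sum>j<N. \<Sum>l<N. (cnj (u i) * v j) * (cnj (U l i) * U l j))"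
    by (intro sum.cong refl sum.swap)
  also have "\<dots> = (\<Sum>i<N. \<Sum>j<N. (cnj (u i) * v j) * (if i = j then 1 else 0))"
    using assms unfolding unitary_mat_def sum_distrib_left[symmetric] by (intro sum.cong refl) auto
  also have "\<dots> = ip N u v"
    unfolding ip_def by (intro sum.cong refl) (simp add: if_distrib[of "(*) _"] cong: if_cong)
  finally show ?thesis .
qed

lemma ip_phase_query_self: "ip N (phase_query n x u) (phase_query n x u) = ip N u u"
  unfolding ip_def phase_query_def by (intro sum.cong refl) auto

lemma q_state_norm:
  assumes "\<And>t. t \<le> T \<Longrightarrow> unitary_mat N (U t)" "N > 0" "t \<le> T"
  shows "(\<Sum>j<N. (cmod (q_state n N U x t j))\<^sup>2) = 1"
proof -
  have "ip N (q_state n N U x t) (q_state n N U x t) = 1"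
    using assms(3)
  proof (induction t)
    case 0
    have "ip N (\<lambda>j. if j = 0 then 1 else 0) (\<lambda>j. if j = 0 then 1 else 0) = (\<Sum>j<N. if j = 0 then 1 else 0)"
      unfolding ip_def by (intro sum.cong refl) auto
    then show ?case using assms by (simp add: ip_mat_app)
  next
    case (Suc t)
    then show ?case using assms by (simp add: ip_mat_app ip_phase_query_self)
  qed
  then show ?thesis unfolding ip_self by (metis of_real_eq_1_iff)
qed

text \<open>Each edge obeys \<open>2 * x * y \<le> x\<^sup>2 + y\<^sup>2\<close>, and injectivity
  lets a vertex occur at most once as a source and once as a target.\<close>

lemma matching_sum_bound:
  fixes g :: "'a \<Rightarrow> real"
  assumes "finite I" "finite F" "src ` F \<subseteq> I" "tgt ` F \<subseteq> I" "inj_on src F" "inj_on tgt F"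
  shows "(\<Sum>e\<in>F. 2 * g (src e) * g (tgt e)) \<le> 2 * (\<Sum>i\<in>I. (g i)\<^sup>2)"
proof -
  have half: "(\<Sum>e\<in>F. (g (h e))\<^sup>2) \<le> (\<Sum>i\<in>I. (g i)\<^sup>2)" if "h ` F \<subseteq> I" "inj_on h F" for h
  proof -
    have "(\<Sum>e\<in>F. (g (h e))\<^sup>2) = (\<Sum>i\<in>h ` F. (g i)\<^sup>2)"
      using that by (simp add: sum.reindex)
    also have "\<dots> \<le> (\<Sum>i\<in>I. (g i)\<^sup>2)"
      using that assms by (intro sum_mono2) auto
    finally show ?thesis .
  qed
  have "(\<Sum>e\<in>F. 2 * g (src e) * g (tgt e)) \<le> (\<Sum>e\<in>F. (g (src e))\<^sup>2 + (g (tgt e))\<^sup>2)"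
    by (intro sum_mono sum_squares_bound)
  also have "\<dots> \<le> 2 * (\<Sum>i\<in>I. (g i)\<^sup>2)"
    using half[of src] half[of tgt] assms by (simp add: sum.distrib)
  finally show ?thesis .
qed

text \<open>Weighted AM-GM with ratio 3/4 on the accepting set and 4/3 off it; the optimal ratio would
  give \<open>2 * sqrt 2 / 3\<close> instead of \<open>17/18\<close>.\<close>

lemma separated_states_overlap:
  assumes u: "(\<Sum>j<N. (cmod (u j))\<^sup>2) = 1" and v: "(\<Sum>j<N. (cmod (v j))\<^sup>2) = 1"
    and p: "(\<Sum>j\<in>S \<inter> {..<N}. (cmod (u j))\<^sup>2) \<ge> 2/3"
    and q: "(\<Sum>j\<in>S \<inter> {..<N}. (cmod (v j))\<^sup>2) \<le> 1/3"
  shows "Re (ip N u v) \<le> 17/18"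
proof -
  have amgm: "a * b \<le> (3/8) * a\<^sup>2 + (2/3) * b\<^sup>2" for a b :: real
  proof -
    have "0 \<le> (3 * a - 4 * b)\<^sup>2 / 24" by simp
    then show ?thesis by (simp add: power2_eq_square algebra_simps)
  qed
  have split: "(\<Sum>j<N. h j) = (\<Sum>j\<in>S \<inter> {..<N}. h j) + (\<Sum>j\<in>{..<N} - S. h j)" for h :: "nat \<Rightarrow> real"
    using sum.Int_Diff[of "{..<N}" h S] by (simp add: Int_commute)
  define p where "p = (\<Sum>j\<in>S \<inter> {..<N}. (cmod (u j))\<^sup>2)"
  define p' where "p' = (\<Sum>j\<in>{..<N} - S. (cmod (u j))\<^sup>2)"
  define q where "q = (\<Sum>j\<in>S \<inter> {..<N}. (cmod (v j))\<^sup>2)"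
  define q' where "q' = (\<Sum>j\<in>{..<N} - S. (cmod (v j))\<^sup>2)"
  have "Re (ip N u v) \<le> (\<Sum>j<N. cmod (u j) * cmod (v j))"
    unfolding ip_def Re_sum
    by (intro sum_mono order.trans[OF complex_Re_le_cmod]) (simp add: norm_mult)
  also have "\<dots> = (\<Sum>j\<in>S \<inter> {..<N}. cmod (u j) * cmod (v j)) + (\<Sum>j\<in>{..<N} - S. cmod (u j) * cmod (v j))"
    by (rule split)
  also have "\<dots> \<le> ((3/8) * p + (2/3) * q) + ((3/8) * q' + (2/3) * p')"
    unfolding p_def q_def p'_def q'_def sum_distrib_left sum.distrib[symmetric]
    by (intro add_mono sum_mono amgm) (metis amgm mult.commute)
  also have "\<dots> \<le> 17/18"
    using u v assms(3,4) unfolding split p_def[symmetric] q_def[symmetric] p'_def[symmetric] q'_def[symmetric]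
    by linarith
  finally show ?thesis .
qed

lemma ip_commute_Re: "Re (ip N u v) = Re (ip N v u)"
  unfolding ip_def Re_sum by (intro sum.cong refl) (simp add: algebra_simps)

text \<open>A query affects the overlap only in components whose query register points at a bit
  where \<open>x\<close> and \<open>y\<close> differ. There the product changes sign, so the loss is
  twice its real part.\<close>

lemma phase_query_overlap:
  "Re (cnj (u j) * v j) - Re (cnj (phase_query n x u j) * phase_query n y v j)
   \<le> (if j mod (n+1) \<noteq> 0 \<and> x ! (j mod (n+1) - 1) \<noteq> y ! (j mod (n+1) - 1)
      then 2 * cmod (u j) * cmod (v j) else 0)"
proof -
  have "Re (cnj (u j) * v j) \<le> cmod (u j) * cmod (v j)"
    by (rule order.trans[OF complex_Re_le_cmod]) (simp add: norm_mult)
  then show ?thesis unfolding phase_query_def by auto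
qed

text \<open>The weighted sum \<open>W\<close> of overlaps along the edges starts at the total edge
  weight, must end at no more than 17/18 of it, and drops by at most \<open>2 * A\<close> per query.
  The injectivity hypotheses say that the edges differing at a fixed bit leave and enter each vertex
  at most once.\<close>

theorem adversary_bound:
  fixes a :: "'a \<Rightarrow> real" and E :: "'e set"
  assumes alg: "q_computes n T k U S f"
    and fin: "finite I" "finite E" and sub: "src ` E \<subseteq> I" "tgt ` E \<subseteq> I"
    and len: "\<And>i. i \<in> I \<Longrightarrow> length (\<phi> i) = n"
    and sep: "\<And>e. e \<in> E \<Longrightarrow> f (\<phi> (src e)) \<noteq> f (\<phi> (tgt e))"
    and inj_src: "\<And>l. l < n \<Longrightarrow> inj_on src {e \<in> E. \<phi> (src e) ! l \<noteq> \<phi> (tgt e) ! l}"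
    and inj_tgt: "\<And>l. l < n \<Longrightarrow> inj_on tgt {e \<in> E. \<phi> (src e) ! l \<noteq> \<phi> (tgt e) ! l}"
    and nonneg: "\<And>i. a i \<ge> 0"
  shows "(\<Sum>e\<in>E. a (src e) * a (tgt e)) \<le> 36 * real T * (\<Sum>i\<in>I. (a i)\<^sup>2)"
proof -
  define N where "N = (n+1) * k"
  define \<psi> where "\<psi> t i = q_state n N U (\<phi> i) t" for t i
  define w where "w e = a (src e) * a (tgt e)" for e
  define W where "W t = (\<Sum>e\<in>E. w e * Re (ip N (\<psi> t (src e)) (\<psi> t (tgt e))))" for t
  define A where "A = (\<Sum>i\<in>I. (a i)\<^sup>2)"
  have "N > 0" and unit: "\<And>t. t \<le> T \<Longrightarrow> unitary_mat N (U t)"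
    using alg unfolding q_computes_def N_def by auto
  have norm: "(\<Sum>j<N. (cmod (\<psi> t i j))\<^sup>2) = 1" if "t \<le> T" for t i
    unfolding \<psi>_def by (rule q_state_norm[OF unit \<open>N > 0\<close> that])
  have w0: "w e \<ge> 0" for e unfolding w_def using nonneg by simp
  \<comment> \<open>No query has been made yet, so the state is the same for all inputs and every
    overlap is 1.\<close>
  have W0: "W 0 = (\<Sum>e\<in>E. w e)"
  proof -
    have "ip N (\<psi> 0 i) (\<psi> 0 i') = 1" for i i'
    proof -
      have "\<psi> 0 i' = \<psi> 0 i" unfolding \<psi>_def by simp
      then show ?thesis using norm[of 0 i] by (simp add: ip_self)
    qed
    then show ?thesis unfolding W_def by simp
  qed
  have WT: "W T \<le> (\<Sum>e\<in>E. w e * (17/18))"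
    unfolding W_def
  proof (intro sum_mono mult_left_mono w0)
    fix e assume e: "e \<in> E"
    have acc: "if f (\<phi> i) then (\<Sum>j\<in>S \<inter> {..<N}. (cmod (\<psi> T i j))\<^sup>2) \<ge> 2/3
               else (\<Sum>j\<in>S \<inter> {..<N}. (cmod (\<psi> T i j))\<^sup>2) \<le> 1/3" if "i \<in> I" for i
      using alg len[OF that] unfolding q_computes_def accept_prob_def N_def \<psi>_def by fastforce
    have I: "src e \<in> I" "tgt e \<in> I" using e sub by auto
    show "Re (ip N (\<psi> T (src e)) (\<psi> T (tgt e))) \<le> 17/18"
    proof (cases "f (\<phi> (src e))")
      case True
      then show ?thesis
        using sep[OF e] acc[OF I(1)] acc[OF I(2)] norm
        by (intro separated_states_overlap[where S = S]) auto
    next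
      case False
      then show ?thesis
        using sep[OF e] acc[OF I(1)] acc[OF I(2)] norm
        by (subst ip_commute_Re, intro separated_states_overlap[where S = S]) auto
    qed
  qed
  \<comment> \<open>The loss is sorted by basis state \<open>j\<close>: only edges differing at the
    bit that \<open>j\<close> queries contribute, and \<open>matching_sum_bound\<close> applies to
    these. Summing over \<open>j\<close> then uses that the states have norm 1.\<close>
  have step: "W t - W (Suc t) \<le> 2 * A" if t: "Suc t \<le> T" for t
  proof -
    define b where "b j = j mod (n+1)" for j
    define F where "F j = {e \<in> E. b j \<noteq> 0 \<and> \<phi> (src e) ! (b j - 1) \<noteq> \<phi> (tgt e) ! (b j - 1)}" for j
    define g where "g j i = a i * cmod (\<psi> t i j)" for j i
    have ipS: "ip N (\<psi> (Suc t) i) (\<psi> (Suc t) i')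
        = ip N (phase_query n (\<phi> i) (\<psi> t i)) (phase_query n (\<phi> i') (\<psi> t i'))" for i i'
      unfolding \<psi>_def by (simp add: ip_mat_app[OF unit[OF t]])
    have "W t - W (Suc t) = (\<Sum>e\<in>E. w e * (\<Sum>j<N. Re (cnj (\<psi> t (src e) j) * \<psi> t (tgt e) j)
         - Re (cnj (phase_query n (\<phi> (src e)) (\<psi> t (src e)) j) * phase_query n (\<phi> (tgt e)) (\<psi> t (tgt e)) j)))"
      unfolding W_def ipS unfolding ip_def Re_sum sum_subtractf right_diff_distrib ..
    also have "\<dots> \<le> (\<Sum>e\<in>E. w e * (\<Sum>j<N. if b j \<noteq> 0 \<and> \<phi> (src e) ! (b j - 1) \<noteq> \<phi> (tgt e) ! (b j - 1)
        then 2 * cmod (\<psi> t (src e) j) * cmod (\<psi> t (tgt e) j) else 0))"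
      unfolding b_def by (intro sum_mono mult_left_mono w0 phase_query_overlap)
    also have "\<dots> = (\<Sum>j<N. \<Sum>e\<in>E. if b j \<noteq> 0 \<and> \<phi> (src e) ! (b j - 1) \<noteq> \<phi> (tgt e) ! (b j - 1)
        then 2 * g j (src e) * g j (tgt e) else 0)"
      unfolding sum_distrib_left w_def g_def
      by (subst sum.swap, intro sum.cong refl) (auto simp: algebra_simps)
    also have "\<dots> = (\<Sum>j<N. \<Sum>e\<in>F j. 2 * g j (src e) * g j (tgt e))"
      unfolding F_def using fin by (intro sum.cong refl sum.inter_filter[symmetric])
    also have "\<dots> \<le> (\<Sum>j<N. 2 * (\<Sum>i\<in>I. (g j i)\<^sup>2))"
    proof (intro sum_mono matching_sum_bound fin)
      fix j
      show "finite (F j)" "src ` F j \<subseteq> I" "tgt ` F j \<subseteq> I"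
        using fin sub unfolding F_def by auto
      \<comment> \<open>Register value \<open>i \<ge> 1\<close> reads bit \<open>i - 1\<close>. The
        null query, for which truncated subtraction would point at bit 0, has no edges at
        all.\<close>
      have *: "F j = {} \<or> (b j - 1 < n \<and> F j \<subseteq> {e \<in> E. \<phi> (src e) ! (b j - 1) \<noteq> \<phi> (tgt e) ! (b j - 1)})"
      proof (cases "b j = 0")
        case False
        have "b j < n + 1" unfolding b_def by (rule mod_less_divisor) simp
        with False show ?thesis unfolding F_def by auto
      qed (simp add: F_def)
      show "inj_on src (F j)" using * inj_src inj_on_subset by fastforce
      show "inj_on tgt (F j)" using * inj_tgt inj_on_subset by fastforce
    qed
    also have "\<dots> = 2 * (\<Sum>i\<in>I. (a i)\<^sup>2 * (\<Sum>j<N. (cmod (\<psi> t i j))\<^sup>2))"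
      unfolding g_def power_mult_distrib sum_distrib_left by (rule sum.swap)
    also have "\<dots> = 2 * A"
      using norm t unfolding A_def by simp
    finally show ?thesis .
  qed
  have "W 0 - W t \<le> real t * (2 * A)" if "t \<le> T" for t
    using that
  proof (induction t)
    case (Suc t)
    then show ?case using step[of t] by (simp add: algebra_simps)
  qed simp
  \<comment> \<open>At least 1/18 of the total weight has to be lost, at most \<open>2 * A\<close>
    per query; this gives the factor 36.\<close>
  from this[of T] have "(\<Sum>e\<in>E. w e) - (\<Sum>e\<in>E. w e) * (17/18) \<le> real T * (2 * A)"
    using W0 WT unfolding sum_distrib_right by linarith
  then show ?thesis unfolding w_def A_def by (simp add: algebra_simps)
qed

section \<open>Huang's sensitivity argument\<close>

text \<open>Gaussian elimination, by induction on the equations: a nonzero coefficient in equation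
  \<open>j0\<close> serves as pivot and removes one equation together with one unknown.\<close>

lemma underdetermined_system:
  fixes a :: "'j \<Rightarrow> 'i \<Rightarrow> real"
  assumes "finite J" "finite I" "card J < card I"
  shows "\<exists>u. (\<exists>i\<in>I. u i \<noteq> 0) \<and> (\<forall>i. i \<notin> I \<longrightarrow> u i = 0) \<and> (\<forall>j\<in>J. (\<Sum>i\<in>I. a j i * u i) = 0)"
  using assms
proof (induction J arbitrary: I a rule: finite_induct)
  case empty
  then obtain i where "i \<in> I" by fastforce
  then show ?case by (intro exI[of _ "\<lambda>i. if i \<in> I then 1 else 0"]) auto
next
  case (insert j0 J)
  show ?case
  proof (cases "\<forall>i\<in>I. a j0 i = 0")
    case True
    have "card J < card I" using insert by simp
    with insert.IH[OF insert.prems(1), of a] True show ?thesis by auto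
  next
    case False
    then obtain i0 where i0: "i0 \<in> I" "a j0 i0 \<noteq> 0" by auto
    define I' where "I' = I - {i0}"
    have I': "finite I'" "card J < card I'" "i0 \<notin> I'" "I = insert i0 I'"
      using insert i0 by (auto simp: I'_def)
    \<comment> \<open>Row \<open>j\<close> minus the multiple of row \<open>j0\<close> that cancels
      the entry at \<open>i0\<close>.\<close>
    define a' where "a' j i = a j i - a j i0 * a j0 i / a j0 i0" for j i
    obtain u where u: "\<exists>i\<in>I'. u i \<noteq> 0" "\<And>i. i \<notin> I' \<Longrightarrow> u i = 0"
      "\<And>j. j \<in> J \<Longrightarrow> (\<Sum>i\<in>I'. a' j i * u i) = 0"
      using insert.IH[OF I'(1,2), of a'] by blast
    \<comment> \<open>Back substitution: the value of the unknown \<open>i0\<close> that satisfies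
      equation \<open>j0\<close>.\<close>
    define c where "c = - (\<Sum>i\<in>I'. a j0 i * u i) / a j0 i0"
    define u' where "u' = u(i0 := c)"
    have sum: "(\<Sum>i\<in>I. a j i * u' i) = a j i0 * c + (\<Sum>i\<in>I'. a j i * u i)" for j
    proof -
      have "(\<Sum>i\<in>I'. a j i * u' i) = (\<Sum>i\<in>I'. a j i * u i)"
        using I' by (intro sum.cong) (auto simp: u'_def)
      then show ?thesis using I' by (simp add: u'_def)
    qed
    have "(\<Sum>i\<in>I. a j i * u' i) = 0" if "j \<in> J" for j
    proof -
      have "(\<Sum>i\<in>I'. a' j i * u i) = (\<Sum>i\<in>I'. a j i * u i) + a j i0 * c"
        unfolding a'_def c_def
        by (simp add: sum_subtractf algebra_simps sum_distrib_left sum_divide_distrib)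
      then show ?thesis using u(3)[OF that] sum[of j] by simp
    qed
    moreover have "(\<Sum>i\<in>I. a j0 i * u' i) = 0"
      using i0 unfolding sum c_def by simp
    moreover have "\<exists>i\<in>I. u' i \<noteq> 0"
      using u(1) I' by (auto simp: u'_def)
    moreover have "\<forall>i. i \<notin> I \<longrightarrow> u' i = 0"
      using u(2) I' by (auto simp: u'_def)
    ultimately show ?thesis by blast
  qed
qed

section \<open>The cube of subsets and its signed adjacency operator\<close>

definition toggle :: "nat \<Rightarrow> nat set \<Rightarrow> nat set" where
  "toggle i B = (if i \<in> B then B - {i} else insert i B)"

lemma toggle_toggle [simp]: "toggle i (toggle i B) = B"
  by (auto simp: toggle_def)

lemma toggle_commute: "toggle i (toggle j B) = toggle j (toggle i B)"
  by (auto simp: toggle_def)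

lemma in_toggle: "j \<in> toggle i B \<longleftrightarrow> (if i = j then j \<notin> B else j \<in> B)"
  by (auto simp: toggle_def)

lemma toggle_in_Pow: "i \<in> M \<Longrightarrow> B \<in> Pow M \<Longrightarrow> toggle i B \<in> Pow M"
  by (auto simp: toggle_def)

lemma even_card_toggle: "finite B \<Longrightarrow> even (card (toggle i B)) \<longleftrightarrow> odd (card B)"
  by (auto simp: toggle_def card_gt_0_iff)

text \<open>The Jordan-Wigner sign: -1 to the number of elements of \<open>B\<close> below
  \<open>i\<close>. It makes moves in different directions anticommute.\<close>

definition huang_sign :: "nat set \<Rightarrow> nat \<Rightarrow> real" where
  "huang_sign B i = (\<Prod>j<i. if j \<in> B then -1 else 1)"

definition huang_op :: "nat set \<Rightarrow> (nat set \<Rightarrow> real) \<Rightarrow> nat set \<Rightarrow> real" where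
  "huang_op M u B = (\<Sum>i\<in>M. huang_sign B i * u (toggle i B))"

lemma huang_sign_sq [simp]: "huang_sign B i * huang_sign B i = 1"
  unfolding huang_sign_def prod.distrib[symmetric] by (intro prod.neutral) auto

lemma abs_huang_sign: "\<bar>huang_sign B i\<bar> = 1"
  unfolding huang_sign_def abs_prod by (intro prod.neutral) auto

lemma huang_sign_toggle_ge: "j \<le> i \<Longrightarrow> huang_sign (toggle i B) j = huang_sign B j"
  unfolding huang_sign_def by (intro prod.cong) (auto simp: in_toggle)

lemma huang_sign_toggle_less:
  assumes "i < j"
  shows "huang_sign (toggle i B) j = - huang_sign B j"
proof -
  have "(\<Prod>l\<in>{..<j} - {i}. if l \<in> toggle i B then -1 else 1) = (\<Prod>l\<in>{..<j} - {i}. if l \<in> B then -1 else (1::real))"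
    by (intro prod.cong) (auto simp: in_toggle)
  then show ?thesis
    using assms by (simp add: huang_sign_def prod.remove[of "{..<j}" i] in_toggle)
qed

text \<open>Of two directions only the larger one sees in its sign whether the smaller one was
  toggled, so the two ways around a square face of the cube carry opposite signs.\<close>

lemma huang_sign_anticommute:
  assumes "i \<noteq> j"
  shows "huang_sign B i * huang_sign (toggle i B) j = - (huang_sign B j * huang_sign (toggle j B) i)"
  using assms by (cases "i < j") (simp_all add: huang_sign_toggle_ge huang_sign_toggle_less)

text \<open>Moving twice in the same direction returns to \<open>B\<close> with sign 1, once for
  each element of \<open>M\<close>. Moves in two different directions cancel against the same moves
  in the opposite order.\<close>

lemma huang_op_square:
  assumes "finite M"
  shows "huang_op M (huang_op M u) B = real (card M) * u B"
proof -
  define t where "t i j = huang_sign B i * huang_sign (toggle i B) j * u (toggle j (toggle i B))" for i j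
  define X where "X = (\<Sum>i\<in>M. \<Sum>j\<in>M. if i = j then 0 else t i j)"
  have t_ii: "t i i = u B" for i
    by (simp add: t_def huang_sign_toggle_ge)
  have anti: "t i j = - t j i" if "i \<noteq> j" for i j
    unfolding t_def using huang_sign_anticommute[OF that] by (simp add: toggle_commute)
  \<comment> \<open>Exchanging the names of the two directions turns \<open>X\<close> into
    \<open>- X\<close>.\<close>
  have "X = (\<Sum>i\<in>M. \<Sum>j\<in>M. if i = j then 0 else t j i)"
    unfolding X_def by (subst sum.swap) (intro sum.cong refl, auto)
  also have "\<dots> = - X"
    unfolding X_def sum_negf[symmetric]
  proof (intro sum.cong refl)
    fix i j
    show "(if i = j then 0 else t j i) = - (if i = j then 0 else t i j)"
      using anti[of j i] by simp
  qed
  finally have "X = 0" by simp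
  have "huang_op M (huang_op M u) B = (\<Sum>i\<in>M. \<Sum>j\<in>M. t i j)"
    unfolding huang_op_def t_def sum_distrib_left by (simp add: mult.assoc)
  also have "\<dots> = (\<Sum>i\<in>M. \<Sum>j\<in>M. (if i = j then u B else 0) + (if i = j then 0 else t i j))"
    by (intro sum.cong refl) (auto simp: t_ii)
  also have "\<dots> = real (card M) * u B + X"
    using assms unfolding X_def by (simp add: sum.distrib)
  finally show ?thesis using \<open>X = 0\<close> by simp
qed

lemma huang_op_linear: "huang_op M (\<lambda>B. u B + c * v B) B = huang_op M u B + c * huang_op M v B"
  unfolding huang_op_def by (simp add: algebra_simps sum.distrib sum_distrib_left)

text \<open>The range of \<open>huang_op M + sqrt (card M)\<close> consists of eigenvectors. Restricting it to functions
  supported on the facet \<open>m \<notin> B\<close> keeps it injective, which gives \<open>2 ^ (card M - 1)\<close> dimensions.\<close>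

lemma huang_eigenvector:
  assumes fin: "finite M" and "M \<noteq> {}" and H: "H \<subseteq> Pow M" and big: "2 ^ card M < 2 * card H"
  obtains v where "\<exists>B\<in>H. v B \<noteq> 0" "\<And>B. B \<in> Pow M - H \<Longrightarrow> v B = 0"
    "\<And>B. huang_op M v B = sqrt (real (card M)) * v B"
proof -
  obtain m where m: "m \<in> M" using assms by auto
  define r where "r = sqrt (real (card M))"
  have r: "r * r = real (card M)" unfolding r_def by simp
  define I where "I = Pow (M - {m})"
  define J where "J = Pow M - H"
  have "2 * card I = 2 ^ card M"
    using fin m by (simp add: I_def card_Pow card_Diff_singleton)
      (metis One_nat_def Suc_pred card_gt_0_iff empty_iff power_Suc)
  moreover have "card J = 2 ^ card M - card H"
    using fin H by (simp add: J_def card_Diff_subset card_Pow finite_subset)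
  \<comment> \<open>Since \<open>H\<close> has more than half of the vertices, vanishing off
    \<open>H\<close> imposes fewer conditions than there are unknowns on the facet.\<close>
  ultimately have card: "card J < card I"
    using big zero_less_power[of "2::nat" "card M"] by linarith
  have fI: "finite I" and fJ: "finite J" using fin by (auto simp: I_def J_def)
  \<comment> \<open>The matrix of \<open>huang_op M\<close> plus \<open>r\<close> times the
    identity, with columns restricted to the facet \<open>I\<close>. The equations for
    \<open>J\<close> make the image \<open>v\<close> of \<open>u\<close> vanish off
    \<open>H\<close>.\<close>
  define a where "a B C = (\<Sum>i\<in>M. huang_sign B i * (if C = toggle i B then 1 else 0)) + r * (if C = B then 1 else 0)" for B C
  obtain u where u: "\<exists>B\<in>I. u B \<noteq> 0" "\<And>B. B \<notin> I \<Longrightarrow> u B = 0"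
    "\<And>B. B \<in> J \<Longrightarrow> (\<Sum>C\<in>I. a B C * u C) = 0"
    using underdetermined_system[OF fJ fI card, of a] by blast
  define v where "v B = huang_op M u B + r * u B" for B
  have pick: "(\<Sum>C\<in>I. (if C = B then 1 else 0) * u C) = u B" for B
  proof -
    have "(\<Sum>C\<in>I. (if C = B then 1 else 0) * u C) = (\<Sum>C\<in>I. if C = B then u C else 0)"
      by (intro sum.cong refl) auto
    also have "\<dots> = u B" using fI u(2)[of B] by simp
    finally show ?thesis .
  qed
  have sum_a: "(\<Sum>C\<in>I. a B C * u C) = v B" for B
  proof -
    have "(\<Sum>C\<in>I. a B C * u C)
        = (\<Sum>C\<in>I. \<Sum>i\<in>M. huang_sign B i * ((if C = toggle i B then 1 else 0) * u C))
          + (\<Sum>C\<in>I. r * ((if C = B then 1 else 0) * u C))"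
      unfolding a_def by (simp only: distrib_right sum.distrib sum_distrib_right mult.assoc)
    also have "\<dots> = (\<Sum>i\<in>M. huang_sign B i * (\<Sum>C\<in>I. (if C = toggle i B then 1 else 0) * u C))
          + r * (\<Sum>C\<in>I. (if C = B then 1 else 0) * u C)"
      unfolding sum_distrib_left by (subst sum.swap) simp
    also have "\<dots> = v B" unfolding pick v_def huang_op_def ..
    finally show ?thesis .
  qed
  have v0: "v B = 0" if "B \<in> Pow M - H" for B
    using u(3)[of B] that unfolding sum_a J_def by simp
  \<comment> \<open>As \<open>huang_op M\<close> squares to \<open>r * r\<close>, it maps
    \<open>huang_op M u + r * u\<close> to \<open>r\<close> times itself.\<close>
  have eig: "huang_op M v B = r * v B" for B
    unfolding v_def huang_op_linear huang_op_square[OF fin] r[symmetric] by (simp add: algebra_simps)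
  obtain B where B: "B \<in> I" "u B \<noteq> 0" using u by auto
  \<comment> \<open>\<open>B'\<close> lies across from \<open>B\<close> outside the facet, and
    \<open>B\<close> is its only neighbour in the facet, so \<open>v B'\<close> is
    \<open>u B\<close> up to sign. This is the injectivity that keeps \<open>v\<close>
    nonzero.\<close>
  define B' where "B' = insert m B"
  have "v B' \<noteq> 0"
  proof -
    have "u B' = 0" using u(2)[of B'] by (auto simp: B'_def I_def)
    moreover have "huang_op M u B' = (\<Sum>i\<in>M. if i = m then huang_sign B' m * u B else 0)"
      unfolding huang_op_def
    proof (intro sum.cong refl)
      fix i assume "i \<in> M"
      show "huang_sign B' i * u (toggle i B') = (if i = m then huang_sign B' m * u B else 0)"
      proof (cases "i = m")
        case True
        have "toggle m B' = B" using B(1) by (auto simp: B'_def I_def toggle_def)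
        then show ?thesis using True by simp
      next
        case False
        then have "m \<in> toggle i B'" by (simp add: in_toggle B'_def)
        then have "toggle i B' \<notin> I" by (auto simp: I_def)
        then show ?thesis using False u(2) by simp
      qed
    qed
    ultimately show ?thesis
      using B m fin abs_huang_sign[of B' m] by (auto simp: v_def)
  qed
  moreover have "B' \<in> Pow M" using B m by (auto simp: B'_def I_def)
  ultimately have "\<exists>B\<in>H. v B \<noteq> 0" using v0[of B'] by auto
  then show thesis using that v0 eig unfolding r_def by blast
qed

text \<open>Taking absolute values of an eigenvector supported on \<open>H\<close> can only increase
  its quadratic form once all signs are dropped, and only edges inside \<open>H\<close> contribute.
  Each of these is counted in both orientations.\<close>

lemma huang_weight:
  assumes fin: "finite M" and ne: "M \<noteq> {}" and H: "H \<subseteq> Pow M" and big: "2 ^ card M < 2 * card H"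
  obtains a where "\<And>B. a B \<ge> 0" "(\<Sum>B\<in>Pow M. (a B)\<^sup>2) > 0"
    "sqrt (real (card M)) * (\<Sum>B\<in>Pow M. (a B)\<^sup>2)
      \<le> (\<Sum>(B, i)\<in>{(B, i). B \<in> H \<and> i \<in> M \<and> toggle i B \<in> H}. a B * a (toggle i B))"
proof -
  obtain v where v: "\<exists>B\<in>H. v B \<noteq> 0" "\<And>B. B \<in> Pow M - H \<Longrightarrow> v B = 0"
    "\<And>B. huang_op M v B = sqrt (real (card M)) * v B"
    using huang_eigenvector[OF assms] by blast
  define a where "a B = \<bar>v B\<bar>" for B
  define E where "E = {(B, i). B \<in> H \<and> i \<in> M \<and> toggle i B \<in> H}"
  have fP: "finite (Pow M)" using fin by simp
  have pos: "(\<Sum>B\<in>Pow M. (a B)\<^sup>2) > 0"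
  proof -
    obtain B where "B \<in> H" "v B \<noteq> 0" using v by auto
    then show ?thesis
      using H fP by (intro sum_pos2[of _ B]) (auto simp: a_def)
  qed
  have "sqrt (real (card M)) * (\<Sum>B\<in>Pow M. (a B)\<^sup>2) = (\<Sum>B\<in>Pow M. v B * huang_op M v B)"
    unfolding v(3) a_def sum_distrib_left by (intro sum.cong refl) (simp add: power2_eq_square)
  also have "\<dots> = (\<Sum>B\<in>Pow M. \<Sum>i\<in>M. v B * (huang_sign B i * v (toggle i B)))"
    unfolding huang_op_def sum_distrib_left ..
  also have "\<dots> \<le> (\<Sum>B\<in>Pow M. \<Sum>i\<in>M. a B * a (toggle i B))"
  proof (intro sum_mono)
    fix B i
    have "v B * (huang_sign B i * v (toggle i B)) \<le> \<bar>v B * (huang_sign B i * v (toggle i B))\<bar>" by simp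
    then show "v B * (huang_sign B i * v (toggle i B)) \<le> a B * a (toggle i B)"
      by (simp add: abs_mult abs_huang_sign a_def)
  qed
  also have "\<dots> = (\<Sum>(B, i)\<in>Pow M \<times> M. a B * a (toggle i B))"
    by (rule sum.cartesian_product)
  also have "\<dots> = (\<Sum>(B, i)\<in>E. a B * a (toggle i B))"
  proof (rule sum.mono_neutral_right)
    show "finite (Pow M \<times> M)" using fin by simp
    show "E \<subseteq> Pow M \<times> M" using H by (auto simp: E_def)
    show "\<forall>p\<in>Pow M \<times> M - E. (case p of (B, i) \<Rightarrow> a B * a (toggle i B)) = 0"
    proof clarify
      fix B i assume *: "B \<subseteq> M" "i \<in> M" "(B, i) \<notin> E"
      then have "B \<in> Pow M - H \<or> toggle i B \<in> Pow M - H"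
        using toggle_in_Pow[of i M B] by (auto simp: E_def)
      then show "a B * a (toggle i B) = 0" using v(2) by (auto simp: a_def)
    qed
  qed
  finally show thesis using that[of a] pos unfolding E_def by (simp add: a_def)
qed

section \<open>Decision trees from maximal monomials\<close>

definition flip :: "bool list \<Rightarrow> nat set \<Rightarrow> bool list" where
  "flip z B = map (\<lambda>i. if i \<in> B then \<not> z ! i else z ! i) [0..<length z]"

lemma length_flip [simp]: "length (flip z B) = length z"
  by (simp add: flip_def)

lemma nth_flip [simp]: "i < length z \<Longrightarrow> flip z B ! i = (if i \<in> B then \<not> z ! i else z ! i)"
  by (simp add: flip_def)

lemma flip_empty [simp]: "flip z {} = z"
  by (rule nth_equalityI) auto

lemma flip_flip_disjoint: "A \<inter> B = {} \<Longrightarrow> flip (flip z A) B = flip z (A \<union> B)"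
  by (rule nth_equalityI) auto

lemma flip_flip_same [simp]: "flip (flip z A) A = z"
  by (rule nth_equalityI) auto

lemma flip_differences:
  assumes "length x = length z"
  shows "x = flip z {i. i < length z \<and> x ! i \<noteq> z ! i}"
  using assms by (intro nth_equalityI) auto

text \<open>Up to sign, the coefficient at \<open>M\<close> of the multilinear polynomial of \<open>f\<close> restricted to the
  subcube through \<open>z\<close> with free coordinates \<open>M\<close>.\<close>

definition alt_sum :: "(bool list \<Rightarrow> bool) \<Rightarrow> bool list \<Rightarrow> nat set \<Rightarrow> int" where
  "alt_sum f z M = (\<Sum>B\<in>Pow M. (-1) ^ card B * of_bool (f (flip z B)))"

lemma alt_sum_empty [simp]: "alt_sum f z {} = of_bool (f z)"
  by (simp add: alt_sum_def)

text \<open>A discrete derivative in direction \<open>i\<close>: the subsets containing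
  \<open>i\<close> come with the opposite sign and with the base point moved to
  \<open>flip z {i}\<close>.\<close>

lemma alt_sum_insert:
  assumes "finite M" "i \<notin> M"
  shows "alt_sum f z (insert i M) = alt_sum f z M - alt_sum f (flip z {i}) M"
proof -
  have "alt_sum f z (insert i M)
      = alt_sum f z M + (\<Sum>B\<in>insert i ` Pow M. (-1) ^ card B * of_bool (f (flip z B)))"
    unfolding alt_sum_def Pow_insert using assms by (intro sum.union_disjoint) auto
  also have "(\<Sum>B\<in>insert i ` Pow M. (-1) ^ card B * of_bool (f (flip z B)))
      = (\<Sum>B\<in>Pow M. (-1) ^ card (insert i B) * of_bool (f (flip z (insert i B))) :: int)"
    using assms by (subst sum.reindex) (auto simp: inj_on_def)
  also have "\<dots> = (\<Sum>B\<in>Pow M. - ((-1) ^ card B * of_bool (f (flip (flip z {i}) B))))"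
  proof (intro sum.cong refl)
    fix B assume "B \<in> Pow M"
    then have "finite B" "i \<notin> B" using assms finite_subset by auto
    then show "(-1) ^ card (insert i B) * of_bool (f (flip z (insert i B)))
        = - ((-1) ^ card B * of_bool (f (flip (flip z {i}) B)) :: int)"
      by (simp add: flip_flip_disjoint)
  qed
  finally show ?thesis by (simp add: alt_sum_def sum_negf)
qed

text \<open>Splitting off \<open>i\<close> writes the sum as a difference of a term at
  \<open>z\<close> and a term at \<open>flip z {i}\<close>; the flip exchanges the two.\<close>

lemma alt_sum_flip_mem:
  assumes "finite M" "i \<in> M"
  shows "alt_sum f (flip z {i}) M = - alt_sum f z M"
proof -
  have "M = insert i (M - {i})" using assms by auto
  then show ?thesis
    using assms alt_sum_insert[of "M - {i}" i f z] alt_sum_insert[of "M - {i}" i f "flip z {i}"]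
    by simp
qed

text \<open>Splitting off one element of \<open>M\<close> leaves the difference of two equal sums.
  The contrapositive finds a sensitive block inside \<open>M\<close>.\<close>

lemma alt_sum_eq_0_if_constant:
  assumes "finite M" "M \<noteq> {}" "\<And>B. B \<subseteq> M \<Longrightarrow> f (flip z B) = f z"
  shows "alt_sum f z M = 0"
proof -
  obtain i where i: "i \<in> M" using assms by auto
  have M: "M = insert i (M - {i})" using i by auto
  have "f (flip (flip z {i}) B) = f (flip z B)" if "B \<in> Pow (M - {i})" for B
  proof -
    have "flip (flip z {i}) B = flip z (insert i B)" using that by (subst flip_flip_disjoint) auto
    moreover have "insert i B \<subseteq> M" "B \<subseteq> M" using that i by auto
    ultimately show ?thesis using assms(3) by metis
  qed
  then have "alt_sum f (flip z {i}) (M - {i}) = alt_sum f z (M - {i})"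
    unfolding alt_sum_def by (intro sum.cong refl) simp
  then show ?thesis using alt_sum_insert[of "M - {i}" i f z] assms(1) M by simp
qed

text \<open>The subcube of inputs still possible after the coordinates in \<open>R\<close> have been
  read with the values in \<open>z0\<close>.\<close>

definition agree :: "nat \<Rightarrow> nat set \<Rightarrow> bool list \<Rightarrow> bool list \<Rightarrow> bool" where
  "agree n R z0 z \<longleftrightarrow> length z = n \<and> (\<forall>i\<in>R. z ! i = z0 ! i)"

text \<open>A monomial of maximal degree of the restricted function keeps a nonzero coefficient in
  every further restriction of the other variables, so it contains a sensitive block of every input.\<close>

lemma universal_sensitive_set:
  assumes R: "R \<subseteq> {..<n}" and z1: "agree n R z0 z1" and z2: "agree n R z0 z2" and ne: "f z1 \<noteq> f z2"
  obtains M where "M \<subseteq> {..<n} - R" "\<exists>z. length z = n \<and> alt_sum f z M \<noteq> 0"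
    "\<And>z. agree n R z0 z \<Longrightarrow> \<exists>B\<subseteq>M. f (flip z B) \<noteq> f z"
proof -
  have agree_flip: "agree n R z0 (flip z B)" if "agree n R z0 z" "B \<inter> R = {}" for z B
    using that R unfolding agree_def by (auto simp: subset_iff)
  define P where "P M \<longleftrightarrow> M \<subseteq> {..<n} - R \<and> (\<exists>z. agree n R z0 z \<and> alt_sum f z M \<noteq> 0)" for M
  \<comment> \<open>A singleton ensures that the maximal \<open>M\<close> is nonempty. Without one,
    no flip of a free variable would change \<open>f\<close>, and \<open>z1\<close> could be turned
    into \<open>z2\<close> by such flips.\<close>
  have "\<exists>i. P {i}"
  proof (rule ccontr)
    assume none: "\<nexists>i. P {i}"
    have const: "f (flip z {i}) = f z" if "agree n R z0 z" "i \<in> {..<n} - R" for z i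
    proof -
      have "alt_sum f z {i} = 0" using none that unfolding P_def by blast
      then show ?thesis using alt_sum_insert[of "{}" i f z] by (auto simp: of_bool_def split: if_splits)
    qed
    have all: "f (flip z1 X) = f z1" if "finite X" "X \<subseteq> {..<n} - R" for X
      using that
    proof (induction X rule: finite_induct)
      case (insert i X)
      have "flip z1 (insert i X) = flip (flip z1 X) {i}"
        using insert by (subst flip_flip_disjoint) auto
      moreover have "agree n R z0 (flip z1 X)" using insert z1 by (intro agree_flip) auto
      ultimately show ?case using const[of "flip z1 X" i] insert by auto
    qed simp
    have "z2 = flip z1 {i. i < length z1 \<and> z2 ! i \<noteq> z1 ! i}"
      using z1 z2 by (intro flip_differences) (auto simp: agree_def)
    moreover have "f (flip z1 {i. i < length z1 \<and> z2 ! i \<noteq> z1 ! i}) = f z1"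
      using z1 z2 by (intro all) (auto simp: agree_def)
    ultimately show False using ne by simp
  qed
  then obtain i where "P {i}" by auto
  have bound: "card M \<le> n" if "P M" for M
    using that card_mono[of "{..<n}" M] unfolding P_def by auto
  obtain M where M: "P M" and maxM: "\<And>M'. P M' \<Longrightarrow> card M' \<le> card M"
    using ex_has_greatest_nat[of P "{i}" card "Suc n"] \<open>P {i}\<close> bound by (auto simp: less_Suc_eq_le)
  have finM: "finite M" using M finite_subset[of M "{..<n}"] unfolding P_def by auto
  have neM: "M \<noteq> {}" using maxM[OF \<open>P {i}\<close>] by auto
  obtain z where z: "agree n R z0 z" "alt_sum f z M \<noteq> 0" using M unfolding P_def by auto
  \<comment> \<open>For \<open>i \<in> M\<close> the coefficient only changes sign. For
    \<open>i \<notin> M\<close> maximality kills the coefficient at \<open>insert i M\<close>, so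
    \<open>y\<close> and its neighbour have the same coefficient at \<open>M\<close>.\<close>
  have step: "alt_sum f (flip y {i}) M \<noteq> 0" if "agree n R z0 y" "alt_sum f y M \<noteq> 0" "i \<in> {..<n} - R" for y i
  proof (cases "i \<in> M")
    case True
    then show ?thesis using alt_sum_flip_mem[OF finM] that by simp
  next
    case False
    have "\<not> P (insert i M)" using maxM[of "insert i M"] finM False by auto
    then have "alt_sum f y (insert i M) = 0" using M that unfolding P_def by auto
    then show ?thesis using alt_sum_insert[OF finM False, of f y] that by simp
  qed
  have all: "alt_sum f (flip z X) M \<noteq> 0" if "finite X" "X \<subseteq> {..<n} - R" for X
    using that
  proof (induction X rule: finite_induct)
    case empty
    then show ?case using z by simp
  next
    case (insert i X)
    have "flip z (insert i X) = flip (flip z X) {i}"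
      using insert by (subst flip_flip_disjoint) auto
    moreover have "agree n R z0 (flip z X)" using insert z by (intro agree_flip) auto
    ultimately show ?case using step[of "flip z X" i] insert by auto
  qed
  show thesis
  proof (rule that)
    show "M \<subseteq> {..<n} - R" using M unfolding P_def by auto
    show "\<exists>z. length z = n \<and> alt_sum f z M \<noteq> 0" using z unfolding agree_def by auto
    fix y assume y: "agree n R z0 y"
    have "y = flip z {i. i < length z \<and> y ! i \<noteq> z ! i}"
      using z y by (intro flip_differences) (auto simp: agree_def)
    moreover have "alt_sum f (flip z {i. i < length z \<and> y ! i \<noteq> z ! i}) M \<noteq> 0"
      using z y by (intro all) (auto simp: agree_def)
    ultimately have "alt_sum f y M \<noteq> 0" by simp
    then show "\<exists>B\<subseteq>M. f (flip y B) \<noteq> f y"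
      using alt_sum_eq_0_if_constant[OF finM neM] by blast
  qed
qed

section \<open>Decision trees on subcubes\<close>

definition dt_solves :: "nat \<Rightarrow> (bool list \<Rightarrow> bool) \<Rightarrow> nat set \<Rightarrow> bool list \<Rightarrow> nat \<Rightarrow> bool" where
  "dt_solves n f R z0 d \<longleftrightarrow>
    (\<exists>t. dt_valid n t \<and> dt_depth t \<le> d \<and> (\<forall>z. agree n R z0 z \<longrightarrow> dt_eval t z = f z))"

text \<open>The complete tree on \<open>M\<close> is built one query at a time, with the answers
  written into \<open>z0\<close>.\<close>

lemma dt_solves_query_all:
  assumes "finite M" "M \<subseteq> {..<n}" "R \<subseteq> {..<n}" "length z0 = n" "M \<inter> R = {}"
    and "\<And>z. agree n R z0 z \<Longrightarrow> dt_solves n f (R \<union> M) z d"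
  shows "dt_solves n f R z0 (card M + d)"
  using assms
proof (induction M arbitrary: R z0 rule: finite_induct)
  case empty
  then show ?case by (simp add: agree_def)
next
  case (insert m M)
  have branch: "dt_solves n f (insert m R) (z0[m := b]) (card M + d)" for b
  proof (rule insert.IH)
    fix z assume z: "agree n (insert m R) (z0[m := b]) z"
    have "z ! i = z0 ! i" if "i \<in> R" for i
    proof -
      have "i \<noteq> m" using that insert.prems by auto
      then show ?thesis using z that by (auto simp: agree_def)
    qed
    then have "agree n R z0 z" using z by (simp add: agree_def)
    then show "dt_solves n f (insert m R \<union> M) z d" using insert.prems(5) by simp
  qed (use insert in auto)
  obtain t where t: "\<And>b. dt_valid n (t b)" "\<And>b. dt_depth (t b) \<le> card M + d"
    "\<And>b z. agree n (insert m R) (z0[m := b]) z \<Longrightarrow> dt_eval (t b) z = f z"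
    using branch unfolding dt_solves_def by metis
  have "dt_eval (Query m (t False) (t True)) z = f z" if z: "agree n R z0 z" for z
  proof -
    have "agree n (insert m R) (z0[m := z ! m]) z"
      using z insert.prems by (auto simp: agree_def nth_list_update)
    then show ?thesis using t(3)[of "z ! m" z] by (cases "z ! m") auto
  qed
  then show ?case unfolding dt_solves_def
    using t(1,2) insert by (intro exI[of _ "Query m (t False) (t True)"]) auto
qed

lemma dt_solves_mono: "dt_solves n f R z0 d \<Longrightarrow> d \<le> d' \<Longrightarrow> dt_solves n f R z0 d'"
  unfolding dt_solves_def using order.trans by blast

text \<open>A witness for block sensitivity at \<open>z\<close>; the last condition also excludes
  the empty block.\<close>

definition sensitive_blocks :: "(bool list \<Rightarrow> bool) \<Rightarrow> bool list \<Rightarrow> nat set set \<Rightarrow> bool" where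
  "sensitive_blocks f z \<B> \<longleftrightarrow>
    finite \<B> \<and> pairwise disjnt \<B> \<and> (\<forall>B\<in>\<B>. f (flip z B) \<noteq> f z)"

text \<open>Each round queries a set that contains a sensitive block of every remaining input; the blocks found
  in different rounds are disjoint, so there are at most \<open>b\<close> rounds.\<close>

lemma dt_solves_by_rounds:
  assumes bs: "\<And>z \<B>. length z = n \<Longrightarrow> sensitive_blocks f z \<B> \<Longrightarrow> card \<B> \<le> b"
    and deg: "\<And>z M. length z = n \<Longrightarrow> M \<subseteq> {..<n} \<Longrightarrow> alt_sum f z M \<noteq> 0 \<Longrightarrow> card M \<le> d"
    and "R \<subseteq> {..<n}" "length z0 = n"
    and "\<And>z. agree n R z0 z \<Longrightarrow> \<exists>\<B>. sensitive_blocks f z \<B> \<and> \<Union>\<B> \<subseteq> R \<and> b \<le> card \<B> + r"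
  shows "dt_solves n f R z0 (r * d)"
  using assms(3-)
proof (induction r arbitrary: R z0 rule: less_induct)
  case (less r)
  have R: "R \<subseteq> {..<n}" and z0: "length z0 = n"
    by (fact less.prems)+
  \<comment> \<open>The invariant: every input of the subcube already has at least
    \<open>b - r\<close> disjoint sensitive blocks inside \<open>R\<close>, where \<open>r\<close>
    bounds the rounds left.\<close>
  note blocks = less.prems(3)
  show ?case
  proof (cases "\<forall>z. agree n R z0 z \<longrightarrow> f z = f z0")
    case True
    then show ?thesis unfolding dt_solves_def by (intro exI[of _ "Leaf (f z0)"]) auto
  next
    case False
    then obtain z1 where z1: "agree n R z0 z1" "f z1 \<noteq> f z0" by auto
    have "agree n R z0 z0" using z0 by (simp add: agree_def)
    then obtain M where M: "M \<subseteq> {..<n} - R" "\<exists>z. length z = n \<and> alt_sum f z M \<noteq> 0"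
      "\<And>z. agree n R z0 z \<Longrightarrow> \<exists>B\<subseteq>M. f (flip z B) \<noteq> f z"
      using universal_sensitive_set[OF R z1(1) _ z1(2)] by metis
    have finM: "finite M" using M(1) finite_subset[of M "{..<n}"] by auto
    have "card M \<le> d" using deg M by blast
    \<comment> \<open>The block found inside \<open>M\<close> avoids \<open>R\<close>, so it is
      disjoint from the earlier blocks; being nonempty, it is a new one.\<close>
    have more: "\<exists>\<B>. sensitive_blocks f z \<B> \<and> \<Union>\<B> \<subseteq> R \<union> M \<and> Suc b \<le> card \<B> + r"
      if z: "agree n R z0 z" for z
    proof -
      obtain \<B> where B: "sensitive_blocks f z \<B>" "\<Union>\<B> \<subseteq> R" "b \<le> card \<B> + r"
        using blocks[OF z] by auto
      obtain X where X: "X \<subseteq> M" "f (flip z X) \<noteq> f z" using M(3)[OF z] by auto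
      have "X \<noteq> {}" using X(2) by auto
      have disj: "disjnt X Y" if "Y \<in> \<B>" for Y
        using that B(2) X(1) M(1) unfolding disjnt_def by blast
      then have "X \<notin> \<B>" using \<open>X \<noteq> {}\<close> by (auto simp: disjnt_def)
      moreover have "sensitive_blocks f z (insert X \<B>)"
        using B(1) X(2) disj unfolding sensitive_blocks_def by (auto simp: pairwise_insert disjnt_sym)
      ultimately show ?thesis
        using B X(1) by (intro exI[of _ "insert X \<B>"]) (auto simp: sensitive_blocks_def)
    qed
    show ?thesis
    proof (cases r)
      \<comment> \<open>With no rounds left, the additional block would give more than
        \<open>b\<close> of them.\<close>
      case 0
      then obtain \<B> where "sensitive_blocks f z1 \<B>" "Suc b \<le> card \<B>" using more[OF z1(1)] by auto
      then show ?thesis using bs[of z1 \<B>] z1(1) by (simp add: agree_def)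
    next
      case (Suc r')
      have "dt_solves n f R z0 (card M + r' * d)"
      proof (rule dt_solves_query_all[OF finM _ R z0])
        fix z assume z: "agree n R z0 z"
        show "dt_solves n f (R \<union> M) z (r' * d)"
        proof (rule less.IH)
          fix z' assume "agree n (R \<union> M) z z'"
          then have "agree n R z0 z'" using z by (simp add: agree_def)
          from more[OF this] show "\<exists>\<B>. sensitive_blocks f z' \<B> \<and> \<Union>\<B> \<subseteq> R \<union> M \<and> b \<le> card \<B> + r'"
            using Suc by simp
        qed (use R M z in \<open>auto simp: agree_def Suc\<close>)
      qed (use M in auto)
      then show ?thesis by (rule dt_solves_mono) (use Suc \<open>card M \<le> d\<close> in simp)
    qed
  qed
qed

lemma D_le_rounds:
  assumes "\<And>z \<B>. length z = n \<Longrightarrow> sensitive_blocks f z \<B> \<Longrightarrow> card \<B> \<le> b"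
    and "\<And>z M. length z = n \<Longrightarrow> M \<subseteq> {..<n} \<Longrightarrow> alt_sum f z M \<noteq> 0 \<Longrightarrow> card M \<le> d"
  shows "D n f \<le> b * d"
proof -
  have "dt_solves n f {} (replicate n False) (b * d)"
  proof (rule dt_solves_by_rounds[OF assms])
    fix z :: "bool list"
    show "\<exists>\<B>. sensitive_blocks f z \<B> \<and> \<Union>\<B> \<subseteq> {} \<and> b \<le> card \<B> + b"
      by (intro exI[of _ "{}"]) (simp add: sensitive_blocks_def)
  qed auto
  then obtain t where t: "dt_computes n t f" "dt_depth t \<le> b * d"
    unfolding dt_solves_def dt_computes_def agree_def by auto
  have "D n f \<le> dt_depth t"
    unfolding D_def by (rule Least_le) (use t in blast)
  then show ?thesis using t by simp
qed

section \<open>A quantum algorithm that learns its input\<close>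

definition ket :: "nat \<Rightarrow> nat \<Rightarrow> complex" where
  "ket p l = (if l = p then 1 else 0)"

text \<open>The query register is the remainder modulo \<open>n+1\<close>, as
  \<open>phase_query\<close> reads it.\<close>

definition enc :: "nat \<Rightarrow> nat \<times> nat \<Rightarrow> nat" where
  "enc n = (\<lambda>(w, r). w * (n+1) + r)"

definition dec :: "nat \<Rightarrow> nat \<Rightarrow> nat \<times> nat" where
  "dec n j = (j div (n+1), j mod (n+1))"

lemma enc_dec [simp]: "enc n (dec n j) = j"
  unfolding enc_def dec_def by (metis case_prod_conv div_mult_mod_eq)

lemma dec_enc [simp]:
  assumes "r \<le> n" shows "dec n (enc n (w, r)) = (w, r)"
proof -
  have "(w * (n+1) + r) div (n+1) = w" using assms by (subst div_mult_self3) auto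
  moreover have "(w * (n+1) + r) mod (n+1) = r" using assms by (subst mod_mult_self3) auto
  ultimately show ?thesis unfolding enc_def dec_def by simp
qed

lemma enc_mod: "r \<le> n \<Longrightarrow> enc n (w, r) mod (n+1) = r"
  using dec_enc[of r n w] by (simp add: dec_def)

lemma enc_less:
  assumes "w < k" "r \<le> n" shows "enc n (w, r) < (n+1) * k"
proof -
  have "enc n (w, r) < Suc w * (n+1)" using assms by (simp add: enc_def)
  also have "\<dots> \<le> k * (n+1)" using assms by (intro mult_right_mono) auto
  finally show ?thesis by (simp add: mult.commute)
qed

lemma dec_bounds:
  assumes "j < (n+1) * k" shows "fst (dec n j) < k" "snd (dec n j) \<le> n"
  using assms less_mult_imp_div_less[of j k "n+1"] mod_less_divisor[of "n+1" j]
  by (auto simp: dec_def mult.commute simp del: mod_less_divisor)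

lemma enc_inj: "r \<le> n \<Longrightarrow> r' \<le> n \<Longrightarrow> enc n (w, r) = enc n (w', r') \<longleftrightarrow> w = w' \<and> r = r'"
  using dec_enc by (metis prod.inject)

text \<open>Basis states are paired by an involution \<open>s\<close> of (workspace, query register) pairs, and each pair
  is rotated or reflected; this covers both Hadamard gates and permutations.\<close>

definition two_level :: "nat \<Rightarrow> (nat \<times> nat \<Rightarrow> nat \<times> nat) \<Rightarrow> (nat \<times> nat \<Rightarrow> real) \<Rightarrow> (nat \<times> nat \<Rightarrow> real)
    \<Rightarrow> nat \<Rightarrow> nat \<Rightarrow> complex" where
  "two_level n s \<alpha> \<beta> l j = \<alpha> (dec n j) * ket j l + \<beta> (dec n j) * ket (enc n (s (dec n j))) l"

text \<open>On an orbit of two states the matrix has rows (\<alpha>, \<beta>) and (\<beta>,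
  -\<alpha>), which is orthogonal because the squares add up to 1. A fixed state is only multiplied
  by a sign.\<close>

lemma unitary_two_level:
  assumes rng: "\<And>w r. w < k \<Longrightarrow> r \<le> n \<Longrightarrow> fst (s (w, r)) < k \<and> snd (s (w, r)) \<le> n"
    and inv: "\<And>w r. w < k \<Longrightarrow> r \<le> n \<Longrightarrow> s (s (w, r)) = (w, r)"
    and norm: "\<And>p. (\<alpha> p)\<^sup>2 + (\<beta> p)\<^sup>2 = 1"
    and fixed: "\<And>w r. w < k \<Longrightarrow> r \<le> n \<Longrightarrow> s (w, r) = (w, r) \<Longrightarrow> \<beta> (w, r) = 0"
    and moved: "\<And>w r. w < k \<Longrightarrow> r \<le> n \<Longrightarrow> s (w, r) \<noteq> (w, r) \<Longrightarrow>
      \<alpha> (s (w, r)) = - \<alpha> (w, r) \<and> \<beta> (s (w, r)) = \<beta> (w, r)"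
  shows "unitary_mat ((n+1) * k) (two_level n s \<alpha> \<beta>)"
proof -
  define N where "N = (n+1) * k"
  define \<sigma> where "\<sigma> j = enc n (s (dec n j))" for j
  have dj: "\<exists>w r. dec n j = (w, r) \<and> w < k \<and> r \<le> n" if "j < N" for j
    using dec_bounds[of j n k] that unfolding N_def by (metis prod.collapse)
  have dec\<sigma>: "dec n (\<sigma> j) = s (dec n j)" if "j < N" for j
    using dj[OF that] rng unfolding \<sigma>_def by (metis dec_enc prod.collapse)
  have \<sigma>N: "\<sigma> j < N" if "j < N" for j
    using dj[OF that] rng unfolding \<sigma>_def N_def by (metis enc_less prod.collapse)
  have \<sigma>\<sigma>: "\<sigma> (\<sigma> j) = j" if "j < N" for j
    using dj[OF that] inv dec\<sigma>[OF that] unfolding \<sigma>_def by (metis enc_dec)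
  define A where "A j = complex_of_real (\<alpha> (dec n j))" for j
  define B where "B j = complex_of_real (\<beta> (dec n j))" for j
  have fixB: "B j = 0" if "j < N" "\<sigma> j = j" for j
    using dj[OF that(1)] fixed dec\<sigma>[OF that(1)] that(2) unfolding B_def by (metis of_real_0)
  have mv: "A (\<sigma> j) = - A j" "B (\<sigma> j) = B j" if j: "j < N" and ne: "\<sigma> j \<noteq> j" for j
  proof -
    obtain w r where wr: "dec n j = (w, r)" "w < k" "r \<le> n" using dj[OF j] by blast
    then have "s (w, r) \<noteq> (w, r)" using ne unfolding \<sigma>_def by (metis enc_dec)
    then show "A (\<sigma> j) = - A j" "B (\<sigma> j) = B j"
      using moved wr dec\<sigma>[OF j] by (simp_all add: A_def B_def)
  qed
  have nrm: "A j * A j + B j * B j = 1" for j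
    using norm[of "dec n j"]
    unfolding A_def B_def of_real_mult[symmetric] of_real_add[symmetric] power2_eq_square by simp
  have kk: "(\<Sum>l<N. ket p l * ket q l) = (if p = q then 1 else 0)" if "p < N" for p q
  proof -
    have "(\<Sum>l<N. ket p l * ket q l) = (\<Sum>l<N. if l = p then (if p = q then 1 else 0) else 0)"
      by (intro sum.cong refl) (auto simp: ket_def)
    then show ?thesis using that by simp
  qed
  have cnj_simps: "cnj (ket p l) = ket p l" "cnj (A p) = A p" "cnj (B p) = B p" for p l
    by (simp_all add: ket_def A_def B_def)
  have "(\<Sum>l<N. cnj (two_level n s \<alpha> \<beta> l i) * two_level n s \<alpha> \<beta> l j) = (if i = j then 1 else 0)"
    if i: "i < N" and j: "j < N" for i j
  proof -
    have "(\<Sum>l<N. cnj (two_level n s \<alpha> \<beta> l i) * two_level n s \<alpha> \<beta> l j)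
      = (\<Sum>l<N. A i * A j * (ket i l * ket j l) + A i * B j * (ket i l * ket (\<sigma> j) l)
          + B i * A j * (ket (\<sigma> i) l * ket j l) + B i * B j * (ket (\<sigma> i) l * ket (\<sigma> j) l))"
      unfolding two_level_def A_def[symmetric] B_def[symmetric] \<sigma>_def[symmetric]
      by (intro sum.cong refl) (simp add: cnj_simps algebra_simps)
    also have "\<dots> = A i * A j * (if i = j then 1 else 0) + A i * B j * (if i = \<sigma> j then 1 else 0)
          + B i * A j * (if \<sigma> i = j then 1 else 0) + B i * B j * (if \<sigma> i = \<sigma> j then 1 else 0)"
      unfolding sum.distrib sum_distrib_left[symmetric] by (simp only: kk i \<sigma>N)
    also have "\<dots> = (if i = j then 1 else 0)"
    proof (cases "i = j")
      case True
      then show ?thesis using nrm[of j] fixB[OF j] by (cases "\<sigma> j = j") auto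
    next
      \<comment> \<open>Columns of different orbits have disjoint supports. Within one orbit the two
        cross terms cancel, since \<open>A\<close> changes sign under \<open>\<sigma>\<close> and
        \<open>B\<close> does not.\<close>
      case False
      have "\<sigma> i \<noteq> \<sigma> j" using False \<sigma>\<sigma> i j by metis
      moreover have "i = \<sigma> j \<longleftrightarrow> \<sigma> i = j" using \<sigma>\<sigma> i j by metis
      ultimately show ?thesis using False mv[OF j] by auto
    qed
    finally show ?thesis .
  qed
  then show ?thesis unfolding unitary_mat_def N_def by simp
qed

lemma mat_app_kets:
  assumes "p < N" "q < N"
  shows "mat_app N U (\<lambda>l. a * ket p l + b * ket q l) = (\<lambda>i. a * U i p + b * U i q)"
proof
  fix i
  have pick: "(\<Sum>j<N. c * (U i j * ket p j)) = c * U i p" if "p < N" for p c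
  proof -
    have "(\<Sum>j<N. c * (U i j * ket p j)) = (\<Sum>j<N. if j = p then c * U i p else 0)"
      by (intro sum.cong refl) (auto simp: ket_def)
    then show ?thesis using that by simp
  qed
  have "mat_app N U (\<lambda>l. a * ket p l + b * ket q l) i
      = (\<Sum>j<N. a * (U i j * ket p j)) + (\<Sum>j<N. b * (U i j * ket q j))"
    unfolding mat_app_def sum.distrib[symmetric] by (intro sum.cong refl) (simp add: algebra_simps)
  then show "mat_app N U (\<lambda>l. a * ket p l + b * ket q l) i = a * U i p + b * U i q"
    using pick assms by simp
qed

lemma mat_app_ket:
  assumes "p < N"
  shows "mat_app N U (\<lambda>l. a * ket p l) = (\<lambda>i. a * U i p)"
  using mat_app_kets[OF assms assms, of U a 0] by simp

section \<open>Queries and gates of the learning algorithm\<close>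

definition query_sign :: "nat \<Rightarrow> bool list \<Rightarrow> nat \<Rightarrow> complex" where
  "query_sign n x j = (if j mod (n+1) = 0 then 1 else if x ! (j mod (n+1) - 1) then -1 else 1)"

lemma phase_query_kets:
  "phase_query n x (\<lambda>l. a * ket p l + b * ket q l)
    = (\<lambda>l. (query_sign n x p * a) * ket p l + (query_sign n x q * b) * ket q l)"
  unfolding phase_query_def query_sign_def by (auto simp: ket_def fun_eq_iff)

lemma phase_query_ket:
  "phase_query n x (\<lambda>l. a * ket p l) = (\<lambda>l. (query_sign n x p * a) * ket p l)"
  unfolding phase_query_def query_sign_def by (auto simp: ket_def fun_eq_iff)

text \<open>A Hadamard gate on two levels of the query register: the null query \<open>0\<close> and
  the level \<open>m+1\<close> that reads bit \<open>m\<close>.\<close>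

definition had :: "nat \<Rightarrow> nat \<Rightarrow> nat \<Rightarrow> nat \<Rightarrow> complex" where
  "had n m = two_level n
    (\<lambda>(w, r). if r = 0 then (w, m+1) else if r = m+1 then (w, 0) else (w, r))
    (\<lambda>(w, r). if r = 0 then 1 / sqrt 2 else if r = m+1 then - 1 / sqrt 2 else 1)
    (\<lambda>(w, r). if r = 0 \<or> r = m+1 then 1 / sqrt 2 else 0)"

definition store_swap :: "nat \<Rightarrow> nat \<times> nat \<Rightarrow> nat \<times> nat" where
  "store_swap m = (\<lambda>(w, r). if r = m+1 \<and> w < 2^m then (w + 2^m, 0)
     else if r = 0 \<and> 2^m \<le> w \<and> w < 2^(m+1) then (w - 2^m, m+1) else (w, r))"

definition store :: "nat \<Rightarrow> nat \<Rightarrow> nat \<Rightarrow> nat \<Rightarrow> complex" where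
  "store n m = two_level n (store_swap m)
    (\<lambda>p. if store_swap m p = p then 1 else 0) (\<lambda>p. if store_swap m p = p then 0 else 1)"

lemma unitary_had: "m < n \<Longrightarrow> unitary_mat ((n+1) * k) (had n m)"
  unfolding had_def
  by (rule unitary_two_level) (auto simp: power_divide split: if_splits)

lemma unitary_store:
  assumes "m < n"
  shows "unitary_mat ((n+1) * 2^n) (store n m)"
proof -
  have "(2::nat) ^ (m+1) \<le> 2 ^ n" using assms by (intro power_increasing) auto
  then show ?thesis unfolding store_def
    using assms by (intro unitary_two_level) (auto simp: store_swap_def split: if_splits)
qed

lemma unitary_id: "unitary_mat N (\<lambda>l j. ket j l)"
proof -
  have "(\<Sum>l<N. cnj (ket i l) * ket j l) = (if i = j then 1 else 0)" if "i < N" for i j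
  proof -
    have "(\<Sum>l<N. cnj (ket i l) * ket j l) = (\<Sum>l<N. if l = i then (if i = j then 1 else 0) else 0)"
      by (intro sum.cong refl) (auto simp: ket_def)
    then show ?thesis using that by simp
  qed
  then show ?thesis unfolding unitary_mat_def by simp
qed

definition code :: "bool list \<Rightarrow> nat \<Rightarrow> nat" where
  "code x m = (\<Sum>i<m. if x ! i then 2^i else 0)"

lemma code_less: "code x m < 2^m"
  by (induction m) (auto simp: code_def)

text \<open>The part below the top bit is less than \<open>2^m\<close>, so equal codes have equal
  top bits and equal remainders.\<close>

lemma code_inj: "code x m = code y m \<Longrightarrow> i < m \<Longrightarrow> x ! i = y ! i"
proof (induction m)
  case (Suc m)
  have c: "code z (Suc m) = code z m + (if z ! m then 2^m else 0)" for z
    by (simp add: code_def)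
  have "x ! m = y ! m \<and> code x m = code y m"
    using Suc.prems(1) code_less[of x m] code_less[of y m] unfolding c by (auto split: if_splits)
  then show ?case using Suc by (auto simp: less_Suc_eq)
qed simp

text \<open>Three queries per bit: steps \<open>3m+1\<close> and \<open>3m+2\<close> bring bit \<open>m\<close> into the query register by phase kickback,
  and step \<open>3m+3\<close> moves it to the workspace. The query before step \<open>3m+1\<close> is null and the one before
  step \<open>3m+3\<close> only changes the global sign; they are spent so that each step is a single gate.\<close>

definition learn :: "nat \<Rightarrow> nat \<Rightarrow> nat \<Rightarrow> nat \<Rightarrow> complex" where
  "learn n t = (if t = 0 then (\<lambda>l j. ket j l)
     else if t mod 3 = 0 then store n (t div 3 - 1) else had n (t div 3))"

lemma had_column:
  assumes "m < n"
  shows "had n m l (enc n (w, 0)) = 1 / sqrt 2 * ket (enc n (w, 0)) l + 1 / sqrt 2 * ket (enc n (w, m+1)) l"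
    "had n m l (enc n (w, m+1)) = - 1 / sqrt 2 * ket (enc n (w, m+1)) l + 1 / sqrt 2 * ket (enc n (w, 0)) l"
  using assms unfolding had_def two_level_def by simp_all

lemma store_column:
  assumes "m < n" "w < 2^m"
  shows "store n m l (enc n (w, 0)) = ket (enc n (w, 0)) l"
    "store n m l (enc n (w, m+1)) = ket (enc n (w + 2^m, 0)) l"
  using assms unfolding store_def two_level_def by (simp_all add: store_swap_def)

lemma q_state_learn:
  assumes "m \<le> n" "length x = n"
  shows "\<exists>c. cmod c = 1 \<and> q_state n ((n+1) * 2^n) (learn n) x (3 * m) = (\<lambda>l. c * ket (enc n (code x m, 0)) l)"
  using assms(1)
proof (induction m)
  case 0
  have "q_state n ((n+1) * 2^n) (learn n) x 0 = mat_app ((n+1) * 2^n) (\<lambda>l j. ket j l) (\<lambda>l. 1 * ket 0 l)"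
    by (simp add: learn_def ket_def)
  also have "\<dots> = (\<lambda>l. 1 * ket 0 l)" by (subst mat_app_ket) auto
  finally show ?case by (intro exI[of _ 1]) (simp add: code_def enc_def)
next
  case (Suc m)
  define N where "N = (n+1) * 2^n"
  define w where "w = code x m"
  define p where "p = enc n (w, 0)"
  define q where "q = enc n (w, m+1)"
  define s where "s = query_sign n x q"
  have m: "m < n" using Suc by simp
  have wm: "w < 2^m" unfolding w_def by (rule code_less)
  also have "(2::nat)^m \<le> 2^n" using m by (intro power_increasing) auto
  finally have "w < 2^n" .
  then have pN: "p < N" and qN: "q < N" using m unfolding p_def q_def N_def by (intro enc_less; simp)+
  have sp: "query_sign n x p = 1" unfolding p_def query_sign_def by (simp only: enc_mod) simp
  have sq: "s = (if x ! m then -1 else 1)"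
  proof -
    have "q mod (n+1) = m+1" unfolding q_def using m by (intro enc_mod) simp
    then show ?thesis unfolding s_def query_sign_def by simp
  qed
  obtain c where c: "cmod c = 1" "q_state n N (learn n) x (3 * m) = (\<lambda>l. c * ket p l)"
    using Suc unfolding N_def p_def w_def by auto
  have l1: "learn n (Suc (3 * m)) = had n m" and l2: "learn n (Suc (Suc (3 * m))) = had n m"
    and l3: "learn n (Suc (Suc (Suc (3 * m)))) = store n m"
  proof -
    have "Suc (3 * m) mod 3 = 1" "Suc (3 * m) div 3 = m" "Suc (Suc (3 * m)) mod 3 = 2" "Suc (Suc (3 * m)) div 3 = m"
      "Suc (Suc (Suc (3 * m))) mod 3 = 0" "Suc (Suc (Suc (3 * m))) div 3 = Suc m"
      by presburger+
    then show "learn n (Suc (3 * m)) = had n m" "learn n (Suc (Suc (3 * m))) = had n m"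
      "learn n (Suc (Suc (Suc (3 * m)))) = store n m" unfolding learn_def by auto
  qed
  define h where "h = complex_of_real (1 / sqrt 2)"
  have hh: "h * h = 1/2" unfolding h_def of_real_mult[symmetric] by simp
  have hp: "had n m l p = h * ket p l + h * ket q l" and hq: "had n m l q = - h * ket q l + h * ket p l" for l
    using had_column[OF m, of l w] unfolding p_def q_def h_def by simp_all
  have st1: "q_state n N (learn n) x (Suc (3 * m)) = (\<lambda>l. (c * h) * ket p l + (c * h) * ket q l)"
    unfolding q_state.simps(2) c(2) l1 phase_query_ket mat_app_ket[OF pN] sp hp
    by (simp add: fun_eq_iff algebra_simps)
  \<comment> \<open>The second Hadamard turns the kicked-back sign \<open>s\<close> into a position:
    the amplitudes are \<open>(1 + s) / 2\<close> at \<open>p\<close> and \<open>(1 - s) / 2\<close>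
    at \<open>q\<close>, up to the factor \<open>c\<close>.\<close>
  define y where "y = (if x ! m then q else p)"
  have st2: "q_state n N (learn n) x (Suc (Suc (3 * m))) = (\<lambda>l. c * ket y l)"
  proof -
    have "q_state n N (learn n) x (Suc (Suc (3 * m)))
       = (\<lambda>l. (c * h) * (h * ket p l + h * ket q l) + (s * (c * h)) * (- h * ket q l + h * ket p l))"
      unfolding q_state.simps(2)[of n N "learn n" x "Suc (3 * m)"] st1 l2 phase_query_kets mat_app_kets[OF pN qN] hp hq sp s_def
      by simp
    also have "\<dots> = (\<lambda>l. c * (h * h) * ((1 + s) * ket p l + (1 - s) * ket q l))"
      by (simp add: fun_eq_iff algebra_simps)
    also have "\<dots> = (\<lambda>l. c * ket y l)"
      unfolding hh sq y_def by (simp add: fun_eq_iff)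
    finally show ?thesis .
  qed
  have yN: "y < N" using pN qN by (simp add: y_def)
  have sy: "store n m l y = ket (enc n (code x (Suc m), 0)) l" for l
    using store_column[OF m wm, of l] unfolding y_def p_def q_def by (simp add: code_def w_def)
  have "q_state n N (learn n) x (3 * Suc m) = (\<lambda>l. (query_sign n x y * c) * ket (enc n (code x (Suc m), 0)) l)"
  proof -
    have "3 * Suc m = Suc (Suc (Suc (3 * m)))" by simp
    then show ?thesis
      by (simp only: q_state.simps(2)[of n N "learn n" x "Suc (Suc (3 * m))"] st2 l3 phase_query_ket mat_app_ket[OF yN] sy)
  qed
  moreover have "cmod (query_sign n x y * c) = 1"
    using c(1) by (simp add: norm_mult query_sign_def)
  ultimately show ?case unfolding N_def by blast
qed

lemma q_computes_exists: "\<exists>T k U S. q_computes n T k U S f"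
proof -
  define N where "N = (n+1) * (2::nat)^n"
  define S where "S = {enc n (code x n, 0) | x. length x = n \<and> f x}"
  have "unitary_mat N (learn n t)" if "t \<le> 3 * n" for t
  proof -
    consider "t = 0" | "t \<noteq> 0" "t mod 3 = 0" | "t mod 3 \<noteq> 0" by blast
    then show ?thesis
    proof cases
      case 1
      then show ?thesis by (simp add: learn_def unitary_id)
    next
      case 2
      then have "t div 3 - 1 < n" using that by presburger
      then show ?thesis using 2 unitary_store by (simp add: learn_def N_def)
    next
      case 3
      then have "t div 3 < n" using that by presburger
      moreover have "t \<noteq> 0" using 3 by auto
      ultimately show ?thesis using 3 unitary_had[of "t div 3" n "2^n"] by (simp add: learn_def N_def)
    qed
  qed
  moreover have "accept_prob n (2^n) (learn n) S (3 * n) x = (if f x then 1 else 0)" if x: "length x = n" for x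
  proof -
    define p where "p = enc n (code x n, 0)"
    have "p < N" unfolding p_def N_def by (intro enc_less code_less) simp
    have "p \<in> S \<longleftrightarrow> f x"
    proof
      assume "p \<in> S"
      then obtain y where y: "length y = n" "f y" "code y n = code x n"
        by (auto simp: S_def p_def enc_inj)
      then have "y = x" using x code_inj[of y n x] by (intro nth_equalityI) auto
      then show "f x" using y by simp
    qed (use x in \<open>auto simp: S_def p_def\<close>)
    obtain c where c: "cmod c = 1" "q_state n N (learn n) x (3 * n) = (\<lambda>l. c * ket p l)"
      using q_state_learn[OF order.refl x] unfolding N_def p_def by auto
    have "accept_prob n (2^n) (learn n) S (3 * n) x = (\<Sum>j\<in>S \<inter> {..<N}. if j = p then 1 else 0)"
      unfolding accept_prob_def N_def[symmetric] c(2)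
      by (intro sum.cong refl) (simp add: norm_mult c(1) ket_def)
    also have "\<dots> = (if p \<in> S then 1 else 0)" using \<open>p < N\<close> by simp
    finally show ?thesis using \<open>p \<in> S \<longleftrightarrow> f x\<close> by simp
  qed
  ultimately have "q_computes n (3 * n) (2^n) (learn n) S f"
    unfolding q_computes_def N_def by auto
  then show ?thesis by blast
qed

section \<open>Quartic bound\<close>

text \<open>The adversary bound is applied to a star with centre \<open>z\<close>, represented by
  the empty set, and one leaf \<open>flip z B\<close> for each block. This gives
  \<open>sqrt c \<le> 72 * T\<close>, and 5184 is the square of 72.\<close>

lemma block_sensitivity_bound:
  assumes alg: "q_computes n T k U S f" and z: "length z = n" and \<B>: "sensitive_blocks f z \<B>"
  shows "card \<B> \<le> 5184 * T\<^sup>2"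
proof (cases "\<B> = {}")
  case False
  define c where "c = real (card \<B>)"
  have fin: "finite \<B>" and dis: "pairwise disjnt \<B>" and sens: "\<And>B. B \<in> \<B> \<Longrightarrow> f (flip z B) \<noteq> f z"
    using \<B> unfolding sensitive_blocks_def by auto
  have "c > 0" using False fin unfolding c_def by (simp add: card_gt_0_iff)
  have nonempty: "{} \<notin> \<B>" using sens[of "{}"] by auto
  \<comment> \<open>The weight \<open>sqrt c\<close> gives the centre the same squared weight as all
    \<open>c\<close> leaves together.\<close>
  define a where "a B = (if B = {} then sqrt c else 1)" for B :: "nat set"
  have "(\<Sum>B\<in>\<B>. a {} * a B) \<le> 36 * real T * (\<Sum>B\<in>insert {} \<B>. (a B)\<^sup>2)"
  proof (rule adversary_bound[OF alg, where \<phi> = "flip z" and src = "\<lambda>_. {}" and tgt = "\<lambda>B. B"])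
    \<comment> \<open>All edges share their source, so injectivity asks for at most one edge per
      bit; disjointness of the blocks provides this.\<close>
    fix l assume "l < n"
    then have "B = B'" if "B \<in> \<B>" "B' \<in> \<B>" "flip z {} ! l \<noteq> flip z B ! l" "flip z {} ! l \<noteq> flip z B' ! l" for B B'
      using that dis z by (auto simp: pairwise_def disjnt_def split: if_splits)
    then show "inj_on (\<lambda>_. {} :: nat set) {B \<in> \<B>. flip z {} ! l \<noteq> flip z B ! l}"
      unfolding inj_on_def by blast
  next
    fix B assume "B \<in> \<B>"
    then show "f (flip z {}) \<noteq> f (flip z B)" using sens by simp
  qed (use fin z \<open>c > 0\<close> in \<open>auto simp: a_def\<close>)
  moreover have "(\<Sum>B\<in>\<B>. a {} * a B) = c * sqrt c"
  proof -
    have "(\<Sum>B\<in>\<B>. a {} * a B) = (\<Sum>B\<in>\<B>. sqrt c)"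
      using nonempty by (intro sum.cong refl) (auto simp: a_def)
    then show ?thesis by (simp add: c_def)
  qed
  moreover have "(\<Sum>B\<in>insert {} \<B>. (a B)\<^sup>2) = 2 * c"
  proof -
    have "(\<Sum>B\<in>\<B>. (a B)\<^sup>2) = (\<Sum>B\<in>\<B>. 1)"
      using nonempty by (intro sum.cong refl) (auto simp: a_def)
    then show ?thesis using fin nonempty \<open>c > 0\<close> by (simp add: a_def c_def)
  qed
  ultimately have "c * sqrt c \<le> c * (72 * real T)" by (simp add: algebra_simps)
  then have "sqrt c \<le> 72 * real T" using \<open>c > 0\<close> by simp
  then have "(sqrt c)\<^sup>2 \<le> (72 * real T)\<^sup>2" using \<open>c > 0\<close> by (intro power_mono) auto
  then have "c \<le> real (5184 * T\<^sup>2)" using \<open>c > 0\<close> by (simp add: power_mult_distrib)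
  then show ?thesis unfolding c_def by (simp only: of_nat_le_iff)
qed simp

text \<open>Replacing \<open>f\<close> by its values plus and minus 1 doubles the alternating sum,
  because parity sums to zero over a nonempty cube. The result is the number of agreements with
  parity minus the number of disagreements.\<close>

lemma unbalanced_of_alt_sum:
  assumes fin: "finite M" and ne: "M \<noteq> {}" and nz: "alt_sum f z M \<noteq> 0"
  obtains b where "2 ^ card M < 2 * card {B \<in> Pow M. (f (flip z B) \<longleftrightarrow> even (card B)) = b}"
proof -
  define A where "A = {B \<in> Pow M. (f (flip z B) \<longleftrightarrow> even (card B)) = True}"
  define A' where "A' = {B \<in> Pow M. (f (flip z B) \<longleftrightarrow> even (card B)) = False}"
  have fP: "finite (Pow M)" using fin by simp
  have U: "Pow M = A \<union> A'" "A \<inter> A' = {}" and fA: "finite A" "finite A'"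
    using fP by (auto simp: A_def A'_def)
  have "card A + card A' = 2 ^ card M"
    by (metis U(1) card_Pow card_Un_disjoint[OF fA U(2)] fin)
  have one: "(\<Sum>B\<in>Pow M. (-1) ^ card B) = (0::int)"
    using alt_sum_eq_0_if_constant[OF fin ne, of "\<lambda>_. True" z] by (simp add: alt_sum_def)
  have "2 * alt_sum f z M = 2 * alt_sum f z M - (\<Sum>B\<in>Pow M. (-1) ^ card B)"
    using one by simp
  also have "\<dots> = (\<Sum>B\<in>Pow M. if (f (flip z B) \<longleftrightarrow> even (card B)) then 1 else - 1)"
    unfolding alt_sum_def sum_distrib_left sum_subtractf[symmetric]
    by (intro sum.cong refl) (auto simp: of_bool_def)
  also have "\<dots> = (\<Sum>B\<in>A. 1) + (\<Sum>B\<in>A'. - 1)"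
    unfolding U(1) sum.union_disjoint[OF fA U(2)]
    by (intro arg_cong2[where f = "(+)"] sum.cong refl) (auto simp: A_def A'_def)
  also have "\<dots> = int (card A) - int (card A')" by simp
  finally have "card A \<noteq> card A'" using nz by auto
  then have "2 ^ card M < 2 * card A \<or> 2 ^ card M < 2 * card A'"
    using \<open>card A + card A' = 2 ^ card M\<close> by linarith
  then show thesis using that[of True] that[of False] unfolding A_def A'_def by blast
qed

text \<open>All vertices of \<open>H\<close> relate to parity in the same way, so \<open>f\<close>
  changes along every cube edge inside \<open>H\<close>. The edges of one direction form a matching,
  and the weights from \<open>huang_weight\<close> yield \<open>sqrt (card M) \<le> 36 * T\<close>;
  1296 is the square of 36.\<close>

lemma degree_bound:
  assumes alg: "q_computes n T k U S f" and z: "length z = n" and M: "M \<subseteq> {..<n}"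
    and nz: "alt_sum f z M \<noteq> 0"
  shows "card M \<le> 1296 * T\<^sup>2"
proof (cases "M = {}")
  case False
  have fin: "finite M" using M finite_subset by blast
  obtain b where big: "2 ^ card M < 2 * card {B \<in> Pow M. (f (flip z B) \<longleftrightarrow> even (card B)) = b}"
    using unbalanced_of_alt_sum[OF fin False nz] by blast
  define H where "H = {B \<in> Pow M. (f (flip z B) \<longleftrightarrow> even (card B)) = b}"
  define E where "E = {(B, i). B \<in> H \<and> i \<in> M \<and> toggle i B \<in> H}"
  have H: "H \<subseteq> Pow M" and HM: "\<And>B. B \<in> H \<Longrightarrow> B \<subseteq> M" unfolding H_def by auto
  obtain a where a: "\<And>B. a B \<ge> 0" "(\<Sum>B\<in>Pow M. (a B)\<^sup>2) > 0"
    "sqrt (real (card M)) * (\<Sum>B\<in>Pow M. (a B)\<^sup>2) \<le> (\<Sum>(B, i)\<in>E. a B * a (toggle i B))"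
    using huang_weight[OF fin False H] big unfolding H_def[symmetric] E_def by blast
  define tgt where "tgt = (\<lambda>(B, i). toggle i B)"
  have differ: "flip z (fst e) ! l \<noteq> flip z (tgt e) ! l \<longleftrightarrow> snd e = l" if "l < n" for e l
    using that z by (cases e) (auto simp: tgt_def in_toggle)
  have "(\<Sum>e\<in>E. a (fst e) * a (tgt e)) \<le> 36 * real T * (\<Sum>B\<in>Pow M. (a B)\<^sup>2)"
  proof (rule adversary_bound[OF alg, where \<phi> = "flip z"])
    have "E \<subseteq> Pow M \<times> M" using H by (auto simp: E_def)
    then show "finite E" by (rule finite_subset) (use fin in simp)
  next
    fix e assume "e \<in> E"
    then obtain B i where e: "e = (B, i)" "B \<in> H" "toggle i B \<in> H" by (auto simp: E_def)
    then have "finite B" using H fin finite_subset by blast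
    then show "f (flip z (fst e)) \<noteq> f (flip z (tgt e))"
      using e even_card_toggle[of B i] by (auto simp: tgt_def H_def)
  next
    fix l assume l: "l < n"
    show "inj_on fst {e \<in> E. flip z (fst e) ! l \<noteq> flip z (tgt e) ! l}"
      unfolding differ[OF l] by (auto simp: inj_on_def)
    show "inj_on tgt {e \<in> E. flip z (fst e) ! l \<noteq> flip z (tgt e) ! l}"
      unfolding differ[OF l] by (auto simp: inj_on_def tgt_def) (metis toggle_toggle)+
  qed (use fin z a(1) in \<open>auto simp: E_def tgt_def dest!: HM\<close>)
  then have "sqrt (real (card M)) * (\<Sum>B\<in>Pow M. (a B)\<^sup>2) \<le> (36 * real T) * (\<Sum>B\<in>Pow M. (a B)\<^sup>2)"
    using a(3) by (simp add: tgt_def case_prod_beta)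
  then have "sqrt (real (card M)) \<le> 36 * real T" using a(2) by simp
  then have "(sqrt (real (card M)))\<^sup>2 \<le> (36 * real T)\<^sup>2" by (intro power_mono) auto
  then have "real (card M) \<le> real (1296 * T\<^sup>2)" by (simp add: power_mult_distrib)
  then show ?thesis by linarith
qed simp

theorem theorem1p2:
  shows "\<exists>C::real. \<forall>(n::nat) (f::bool list \<Rightarrow> bool). real (D n f) \<le> C * real (Q n f) ^ 4"
proof (intro exI allI)
  fix n :: nat and f :: "bool list \<Rightarrow> bool"
  \<comment> \<open>The minimum defining \<open>Q\<close> is attained only because some algorithm
    exists.\<close>
  have "\<exists>k U S. q_computes n (Q n f) k U S f"
    unfolding Q_def by (rule LeastI_ex) (rule q_computes_exists)
  then obtain k U S where alg: "q_computes n (Q n f) k U S f" by blast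
  \<comment> \<open>At most as many rounds as the block sensitivity bound allows, each querying one
    monomial.\<close>
  have "D n f \<le> (5184 * (Q n f)\<^sup>2) * (1296 * (Q n f)\<^sup>2)"
    by (intro D_le_rounds block_sensitivity_bound[OF alg] degree_bound[OF alg])
  also have "\<dots> = 5184 * 1296 * Q n f ^ 4" by (simp add: power2_eq_square power4_eq_xxxx)
  finally have "real (D n f) \<le> real (5184 * 1296 * Q n f ^ 4)" by (rule of_nat_mono)
  then show "real (D n f) \<le> 5184 * 1296 * real (Q n f) ^ 4" by simp
qed

end
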